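(* Let $H$ be a collection of probability measures on a measurable space $(\mathcal{X},\mathcal{F})$ equipped with a filtration $(\mathcal{F}_n)_{n\ge 0}$, and fix a level $\alpha>0$. For every $\mathbb{P}\in H$, let $\phi^{\mathbb{P}}:\mathcal{X}\to[0,1]$ be an $\mathcal{F}$-measurable test, let $\phi_n^{\mathbb{P}}:=\mathbb{E}^{\mathbb{P}}[\phi^{\mathbb{P}}\mid\mathcal{F}_n]$ for $n\ge 0$ and $\phi_\infty^{\mathbb{P}}:=\limsup_{n\to\infty}\phi_n^{\mathbb{P}}$, and define $$\phi_n^H:=\operatorname*{ess\,inf}_{\mathbb{P}\in H}\phi_n^{\mathbb{P}}\quad(n\ge0),\qquad \phi_\infty^H:=\operatorname*{ess\,inf}_{\mathbb{P}\in H}\phi_\infty^{\mathbb{P}}.$$ Then: 1. If every test $\phi^{\mathbb{P}}$ is valid for $\mathbb{P}$, then $(\phi_n^H)$ is anytime valid for $H$. 2. Suppose every $\phi^{\mathbb{P}}$ is $\mathcal{F}_\infty$-measurable. If the test $\phi^H:=\operatorname*{ess\,inf}_{\mathbb{P}\in H}\phi^{\mathbb{P}}$ is not valid for $H$, then $(\phi_n^H)$ is not anytime valid for $H$. 3. If $\tau$ is a (possibly infinite) stopping time and every test $\phi^{\mathbb{P}}$, $\mathbb{P}\in H$, is $\mathcal{F}_\tau$-measurable, then $\phi_\tau^H=\operatorname*{ess\,inf}_{\mathbb{P}\in H}\phi^{\mathbb{P}}$ (almost surely).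
   Context: The filtration satisfies $\mathcal{F}_n\subseteq\mathcal{F}$ and $\mathcal{F}_0=\{\emptyset,\mathcal{X}\}$, and $\mathcal{F}_\infty:=\sigma(\bigcup_{n\ge0}\mathcal{F}_n)\subseteq\mathcal{F}$. A test is an $\mathcal{F}$-measurable map $\mathcal{X}\to[0,1]$. A test $\phi$ is valid for $H$ if $\sup_{\mathbb{P}\in H}\mathbb{E}^{\mathbb{P}}[\phi]\le\alpha$, and valid for a single $\mathbb{P}$ if $\mathbb{E}^{\mathbb{P}}[\phi]\le\alpha$. The adapted sequence $(\phi_n^H)$ is anytime valid for $H$ if $\phi^H_\tau$ is valid for $H$ for every (possibly infinite) stopping time $\tau$ with respect to $(\mathcal{F}_n)$, where $\phi_\tau^H=\phi_n^H$ on $\{\tau=n\}$ and $\phi_\tau^H=\phi_\infty^H$ on $\{\tau=\infty\}$. For a stopping time $\tau$, $\mathcal{F}_\tau=\{A\in\mathcal{F}_\infty:A\cap\{\tau\le n\}\in\mathcal{F}_n\ \forall n\ge 0\}$. For a family $(Y^{\mathbb{P}})_{\mathbb{P}\in H}$ of $[0,1]$-valued functions measurable with respect to a $\sigma$-algebra $\mathcal{G}$, where $Y^{\mathbb{P}}$ need only be defined up to $\mathbb{P}$-null sets, $\operatorname*{ess\,inf}_{\mathbb{P}\in H}Y^{\mathbb{P}}$ denotes its greatest measurable almost-sure lower bound: a $\mathcal{G}$-measurable $Y$ with $Y\le Y^{\mathbb{P}}$ $\mathbb{P}$-almost surely for every $\mathbb{P}\in H$, such that any other $\mathcal{G}$-measurable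 $Y'$ with this property satisfies $Y'\le Y$ $\mathbb{P}$-almost surely for every $\mathbb{P}\in H$. Here $\mathcal{G}$ is $\mathcal{F}_n$ for $\phi_n^H$, $\mathcal{F}_\infty$ for $\phi_\infty^H$ and for $\phi^H$ in part 2, and $\mathcal{F}_\tau$ for the right-hand side in part 3. These essential infima are assumed to exist. Equalities of such objects are understood $\mathbb{P}$-almost surely for every $\mathbb{P}\in H$. *)

theory Defs
  imports "HOL-Probability.Probability"
begin

definition is_test :: "'a measure \<Rightarrow> ('a \<Rightarrow> real) \<Rightarrow> bool" where
  "is_test G \<phi> \<longleftrightarrow> \<phi> \<in> borel_measurable G \<and> (\<forall>x\<in>space G. 0 \<le> \<phi> x \<and> \<phi> x \<le> 1)"

(* The supremum is taken in the extended reals, so that it is meaningful for every set H,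
   the empty one included. *)
definition valid_test :: "'a measure \<Rightarrow> real \<Rightarrow> 'a measure set \<Rightarrow> ('a \<Rightarrow> real) \<Rightarrow> bool" where
  "valid_test M \<alpha> H \<phi> \<longleftrightarrow>
     is_test M \<phi> \<and> (SUP P\<in>H. ereal (integral\<^sup>L P \<phi>)) \<le> ereal \<alpha>"

definition F_infinity :: "'a set \<Rightarrow> (nat \<Rightarrow> 'a measure) \<Rightarrow> 'a measure" where
  "F_infinity \<Omega> F = sigma \<Omega> (\<Union>n. sets (F n))"

(* Adjoining F_infinity at index \<infinity> turns possibly infinite stopping times, and their
   sigma-algebras, into instances of the library notions for the index type enat; see the
   lemmas stopping_time_extend_iff and sets_F_stopped below. *)
definition extend_filtration :: "'a set \<Rightarrow> (nat \<Rightarrow> 'a measure) \<Rightarrow> enat \<Rightarrow> 'a measure" where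
  "extend_filtration \<Omega> F t = (case t of enat n \<Rightarrow> F n | \<infinity> \<Rightarrow> F_infinity \<Omega> F)"

definition F_stopped :: "'a set \<Rightarrow> (nat \<Rightarrow> 'a measure) \<Rightarrow> ('a \<Rightarrow> enat) \<Rightarrow> 'a measure" where
  "F_stopped \<Omega> F \<tau> = filtration.pre_sigma \<Omega> (extend_filtration \<Omega> F) \<tau>"

definition stopped_seq :: "(nat \<Rightarrow> 'a \<Rightarrow> real) \<Rightarrow> ('a \<Rightarrow> real) \<Rightarrow> ('a \<Rightarrow> enat) \<Rightarrow> 'a \<Rightarrow> real" where
  "stopped_seq \<phi> \<phi>_inf \<tau> x = (case \<tau> x of enat n \<Rightarrow> \<phi> n x | \<infinity> \<Rightarrow> \<phi>_inf x)"

definition anytime_valid ::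
  "'a measure \<Rightarrow> (nat \<Rightarrow> 'a measure) \<Rightarrow> real \<Rightarrow> 'a measure set \<Rightarrow> (nat \<Rightarrow> 'a \<Rightarrow> real) \<Rightarrow> ('a \<Rightarrow> real) \<Rightarrow> bool"
where
  "anytime_valid M F \<alpha> H \<phi> \<phi>_inf \<longleftrightarrow>
     (\<forall>\<tau>. stopping_time (extend_filtration (space M) F) \<tau> \<longrightarrow>
          valid_test M \<alpha> H (stopped_seq \<phi> \<phi>_inf \<tau>))"

(* Y is a version of the G-measurable essential infimum of the family Z over H. *)
definition is_ess_inf ::
  "'a measure \<Rightarrow> 'a measure set \<Rightarrow> ('a measure \<Rightarrow> 'a \<Rightarrow> real) \<Rightarrow> ('a \<Rightarrow> real) \<Rightarrow> bool"
where
  "is_ess_inf G H Z Y \<longleftrightarrow>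
     Y \<in> borel_measurable G \<and>
     (\<forall>P\<in>H. AE x in P. Y x \<le> Z P x) \<and>
     (\<forall>Y'. Y' \<in> borel_measurable G \<longrightarrow> (\<forall>P\<in>H. AE x in P. Y' x \<le> Z P x) \<longrightarrow>
           (\<forall>P\<in>H. AE x in P. Y' x \<le> Y x))"

definition cond_test :: "(nat \<Rightarrow> 'a measure) \<Rightarrow> ('a measure \<Rightarrow> 'a \<Rightarrow> real) \<Rightarrow> nat \<Rightarrow> 'a measure \<Rightarrow> 'a \<Rightarrow> real" where
  "cond_test F \<phi> n P = real_cond_exp P (F n) (\<phi> P)"

(* The limsup lies in [0,1] outside a P-null set; the values of real_of_ereal at infinite
   arguments therefore play no role. *)
definition cond_test_inf :: "(nat \<Rightarrow> 'a measure) \<Rightarrow> ('a measure \<Rightarrow> 'a \<Rightarrow> real) \<Rightarrow> 'a measure \<Rightarrow> 'a \<Rightarrow> real" where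
  "cond_test_inf F \<phi> P x = real_of_ereal (limsup (\<lambda>n. ereal (cond_test F \<phi> n P x)))"

lemma space_F_infinity:
  assumes "filtration \<Omega> F"
  shows "space (F_infinity \<Omega> F) = \<Omega>"
proof -
  interpret filtration \<Omega> F by fact
  have "sets (F n) \<subseteq> Pow \<Omega>" for n
    using sets.space_closed[of "F n"] by (simp add: space_F)
  then show ?thesis
    unfolding F_infinity_def by (intro space_measure_of) auto
qed

lemma sets_F_subset_F_infinity:
  assumes "filtration \<Omega> F"
  shows "sets (F n) \<subseteq> sets (F_infinity \<Omega> F)"
proof -
  interpret filtration \<Omega> F by fact
  have "sets (F n) \<subseteq> Pow \<Omega>" for n
    using sets.space_closed[of "F n"] by (simp add: space_F)
  then have "sets (F_infinity \<Omega> F) = sigma_sets \<Omega> (\<Union>n. sets (F n))"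
    unfolding F_infinity_def by (intro sets_measure_of) auto
  then show ?thesis by auto
qed

lemma filtration_extend:
  assumes "filtration \<Omega> F"
  shows "filtration \<Omega> (extend_filtration \<Omega> F)"
proof -
  interpret filtration \<Omega> F by fact
  show ?thesis
  proof
    show "space (extend_filtration \<Omega> F i) = \<Omega>" for i
      using space_F_infinity[OF assms] by (auto simp: extend_filtration_def space_F split: enat.split)
  next
    fix i j :: enat assume "i \<le> j"
    then show "sets (extend_filtration \<Omega> F i) \<le> sets (extend_filtration \<Omega> F j)"
      using sets_F_subset_F_infinity[OF assms] sets_F_mono
      by (cases i; cases j) (auto simp: extend_filtration_def)
  qed
qed

lemma stopping_time_extend_iff:
  "stopping_time (extend_filtration \<Omega> F) \<tau> \<longleftrightarrow> (\<forall>n. {x \<in> space (F n). \<tau> x \<le> enat n} \<in> sets (F n))"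
  by (auto simp: stopping_time_def extend_filtration_def pred_def split: enat.split)

lemma sets_F_stopped:
  assumes "filtration \<Omega> F" and "stopping_time (extend_filtration \<Omega> F) \<tau>"
  shows "sets (F_stopped \<Omega> F \<tau>) =
    {A \<in> sets (F_infinity \<Omega> F). \<forall>n. A \<inter> {x \<in> \<Omega>. \<tau> x \<le> enat n} \<in> sets (F n)}"
proof -
  have *: "{x \<in> A. \<tau> x \<le> enat n} = A \<inter> {x \<in> \<Omega>. \<tau> x \<le> enat n}"
    if "A \<in> sets (F_infinity \<Omega> F)" for A n
    using sets.sets_into_space[OF that] space_F_infinity[OF assms(1)] by auto
  have "(\<forall>t. {x \<in> A. \<tau> x \<le> t} \<in> sets (extend_filtration \<Omega> F t)) \<longleftrightarrow>
      A \<in> sets (F_infinity \<Omega> F) \<and> (\<forall>n. {x \<in> A. \<tau> x \<le> enat n} \<in> sets (F n))" (is "?L \<longleftrightarrow> ?R") for A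
  proof
    assume L: ?L
    have "A \<in> sets (F_infinity \<Omega> F)"
      using L[rule_format, of \<infinity>] by (simp add: extend_filtration_def)
    moreover have "{x \<in> A. \<tau> x \<le> enat n} \<in> sets (F n)" for n
      using L[rule_format, of "enat n"] by (simp add: extend_filtration_def)
    ultimately show ?R by simp
  qed (auto simp: extend_filtration_def split: enat.split)
  then show ?thesis
    unfolding F_stopped_def filtration.sets_pre_sigma[OF filtration_extend[OF assms(1)] assms(2)]
    using * by auto
qed

end

theory Submission
  imports Defs
begin

text \<open>
  The process \<open>\<phi>\<^sub>n = E[\<phi> | F\<^sub>n]\<close> is a martingale closed by \<open>\<phi>\<close>, and everything rests on
  Levy's upward theorem: its limit, the \<open>limsup\<close> in the definition of \<open>\<phi>\<^sub>\<infinity>\<close>, is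
  \<open>E[\<phi> | F\<^sub>\<infinity>]\<close> almost surely (\<open>levy_upward\<close>). Time \<open>\<infinity>\<close> thereby stops being special:
  writing \<open>G\<close> for the filtration extended to \<open>enat\<close>, the test at each time \<open>t\<close>, finite or
  not, is \<open>E[\<phi> | G\<^sub>t]\<close>, and its essential infimum over \<open>H\<close> is taken in \<open>G\<^sub>t\<close>. As \<open>enat\<close> is
  countable, a stopping time \<open>\<tau>\<close> cuts the space into countably many pieces
  \<open>{\<tau> = t} \<in> G\<^sub>t\<close>, on each of which a statement about \<open>\<tau>\<close> becomes one about the fixed
  time \<open>t\<close>.

  Part 1: integrating over each piece gives \<open>E[\<phi>\<^sub>\<tau>] = E[\<phi>]\<close> (\<open>optional_stopping\<close>), and
  the stopped essential infimum lies below \<open>\<phi>\<^sub>\<tau>\<close> for every measure in \<open>H\<close>.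

  Part 3: if \<open>\<phi>\<close> is \<open>F\<^sub>\<tau>\<close>-measurable, then \<open>E[\<phi> | G\<^sub>t] = \<phi>\<close> on \<open>{\<tau> = t}\<close>
  (\<open>cond_exp_eq_on_stopped\<close>), so \<open>\<phi>\<^sup>H\<^sub>\<tau>\<close> is a lower bound of the \<open>\<phi>\<close>. It is the greatest
  one because essential infima are local: a competing lower bound may be substituted for
  \<open>\<phi>\<^sup>H\<^sub>t\<close> on \<open>{\<tau> = t}\<close> alone without leaving \<open>G\<^sub>t\<close> (\<open>is_ess_inf_stopped\<close>).

  Part 2 is the contrapositive of the case \<open>\<tau> = \<infinity>\<close> of part 3: there \<open>\<phi>\<^sup>H\<^sub>\<infinity> = \<phi>\<^sup>H\<close>
  almost surely, so anytime validity at \<open>\<tau> = \<infinity>\<close> makes \<open>\<phi>\<^sup>H\<close> valid.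

  Levy's theorem is proved in the classical way: convergence is trivial for functions that
  are measurable with respect to some \<open>F\<^sub>k\<close>, such functions are dense in
  \<open>L\<^sup>1(F\<^sub>\<infinity>)\<close> (\<open>L1_approximable_F_inf\<close>), and Doob's maximal inequality
  (\<open>maximal_inequality\<close>) controls the error uniformly in \<open>n\<close>.
\<close>

section \<open>Filtrations on a probability space\<close>

lemma sets_F_infinity:
  assumes "filtration \<Omega> F"
  shows "sets (F_infinity \<Omega> F) = sigma_sets \<Omega> (\<Union>n. sets (F n))"
proof -
  have "sets (F n) \<subseteq> Pow \<Omega>" for n
    using sets.space_closed[of "F n"] by (simp add: filtration.space_F[OF assms])
  then show ?thesis
    unfolding F_infinity_def by (intro sets_measure_of) auto
qed

lemma subalgebra_F_infinity:
  assumes "filtration (space M) F" and "\<And>n. subalgebra M (F n)"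
  shows "subalgebra M (F_infinity (space M) F)"
proof -
  have "sigma_sets (space M) (\<Union>n. sets (F n)) \<subseteq> sets M"
    using assms(2) by (intro sets.sigma_sets_subset) (auto simp: subalgebra_def)
  then show ?thesis
    by (simp add: subalgebra_def sets_F_infinity[OF assms(1)] space_F_infinity[OF assms(1)])
qed

locale prob_filtration = prob_space P + filtration "space P" F
  for P :: "'a measure" and F :: "nat \<Rightarrow> 'a measure" +
  assumes subalg_F: "\<And>n. subalgebra P (F n)"
begin

abbreviation F_inf :: "'a measure" where
  "F_inf \<equiv> F_infinity (space P) F"

lemma subalg_F_inf: "subalgebra P F_inf"
  by (intro subalgebra_F_infinity filtration_axioms subalg_F)

lemma subalg_F_F_inf: "subalgebra F_inf (F n)"
  using sets_F_subset_F_infinity[OF filtration_axioms] space_F_infinity[OF filtration_axioms]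
  by (auto simp: subalgebra_def space_F)

lemma subalg_extend: "subalgebra P (extend_filtration (space P) F t)"
  using subalg_F subalg_F_inf by (cases t) (auto simp: extend_filtration_def)

lemma cond_exp_subalgebra: "subalgebra P G \<Longrightarrow> sigma_finite_subalgebra P G"
  by (intro finite_measure_subalgebra_is_sigma_finite finite_measure_subalgebra.intro
      finite_measure_axioms finite_measure_subalgebra_axioms.intro)

lemma measurable_F_mono: "m \<le> n \<Longrightarrow> h \<in> borel_measurable (F m) \<Longrightarrow> h \<in> borel_measurable (F n)"
  using sets_F_mono[of m n] by (auto simp: measurable_def space_F)

section \<open>Doob's maximal inequality\<close>

text \<open>
  The sets \<open>A\<^sub>n\<close> where \<open>E[h | F\<^sub>n] > c\<close>, made disjoint, say at which time the level \<open>c\<close> is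
  first exceeded. The \<open>n\<close>-th of these disjoint sets belongs to \<open>F\<^sub>n\<close>, so the conditional
  expectation, which is above \<open>c\<close> there, has the same integral over it as \<open>h\<close>.
\<close>

lemma maximal_inequality:
  fixes h :: "'a \<Rightarrow> real"
  assumes h[measurable]: "integrable P h" and nonneg: "AE x in P. 0 \<le> h x" and "0 < c"
  shows "measure P {x\<in>space P. \<exists>n. c < real_cond_exp P (F n) h x} \<le> (\<integral>x. h x \<partial>P) / c"
proof -
  define A where "A n = {x\<in>space P. c < real_cond_exp P (F n) h x}" for n
  have A_F: "A n \<in> sets (F n)" for n
    using borel_measurable_cond_exp[of P "F n" h] unfolding A_def space_F[of n, symmetric] by measurable
  have D_F: "disjointed A n \<in> sets (F n)" for n
  proof -
    have "A i \<in> sets (F n)" if "i < n" for i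
      using A_F[of i] sets_F_mono[of i n] that by auto
    then show ?thesis
      using A_F[of n] by (auto simp: disjointed_def)
  qed
  have D_P[measurable]: "disjointed A n \<in> sets P" for n
    using D_F subalg_F by (auto simp: subalgebra_def)
  have D_bound: "c * measure P (disjointed A n) \<le> (\<integral>x\<in>disjointed A n. h x \<partial>P)" for n
  proof -
    interpret sigma_finite_subalgebra P "F n"
      by (intro cond_exp_subalgebra subalg_F)
    have "c * measure P (disjointed A n) = (\<integral>x\<in>disjointed A n. c \<partial>P)"
      by (simp add: set_integral_const)
    also have "\<dots> \<le> (\<integral>x\<in>disjointed A n. real_cond_exp P (F n) h x \<partial>P)"
      unfolding set_lebesgue_integral_def
      using disjointed_subset[of A n] real_cond_exp_int(1)[OF h]
      by (intro integral_mono integrable_mult_indicator) (auto simp: A_def split: split_indicator)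
    also have "\<dots> = (\<integral>x\<in>disjointed A n. h x \<partial>P)"
      using real_cond_exp_intA[OF h D_F] by simp
    finally show ?thesis .
  qed
  have "{x\<in>space P. \<exists>n. c < real_cond_exp P (F n) h x} = (\<Union>n. disjointed A n)"
    unfolding UN_disjointed_eq by (auto simp: A_def)
  moreover have "(\<lambda>n. c * measure P (disjointed A n)) sums (c * measure P (\<Union>n. disjointed A n))"
    by (intro sums_mult finite_measure_UNION disjoint_family_disjointed) auto
  moreover have "(\<Sum>n<N. c * measure P (disjointed A n)) \<le> (\<integral>x. h x \<partial>P)" for N
  proof -
    have "(\<Sum>n<N. c * measure P (disjointed A n)) \<le> (\<Sum>n<N. \<integral>x\<in>disjointed A n. h x \<partial>P)"
      by (intro sum_mono D_bound)
    also have "\<dots> = (\<integral>x. (\<Sum>n<N. indicator (disjointed A n) x *\<^sub>R h x) \<partial>P)"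
      unfolding set_lebesgue_integral_def
      using h by (intro Bochner_Integration.integral_sum[symmetric] integrable_mult_indicator) auto
    also have "\<dots> = (\<integral>x. indicator (\<Union>n<N. disjointed A n) x *\<^sub>R h x \<partial>P)"
      using disjoint_family_on_mono[OF subset_UNIV disjoint_family_disjointed[of A]]
      by (intro Bochner_Integration.integral_cong refl)
         (simp only: scaleR_sum_left[symmetric] indicator_UN_disjoint[OF finite_lessThan])
    also have "\<dots> \<le> (\<integral>x. h x \<partial>P)"
      using nonneg h by (intro integral_mono_AE integrable_mult_indicator) (auto split: split_indicator)
    finally show ?thesis .
  qed
  ultimately have "c * measure P {x\<in>space P. \<exists>n. c < real_cond_exp P (F n) h x} \<le> (\<integral>x. h x \<partial>P)"
    unfolding sums_def by (auto intro: LIMSEQ_le_const2)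
  then show ?thesis
    using \<open>0 < c\<close> by (simp add: pos_le_divide_eq mult.commute)
qed

section \<open>Density of the finite-time functions\<close>

definition L1_approximable :: "('a \<Rightarrow> real) \<Rightarrow> bool" where
  "L1_approximable f \<longleftrightarrow> integrable P f \<and>
     (\<forall>\<epsilon>>0. \<exists>k h. h \<in> borel_measurable (F k) \<and> integrable P h \<and> (\<integral>x. \<bar>f x - h x\<bar> \<partial>P) < \<epsilon>)"

lemma L1_approximable_F:
  assumes "h \<in> borel_measurable (F k)" "integrable P h"
  shows "L1_approximable h"
  using assms unfolding L1_approximable_def by (auto intro!: exI[of _ k] exI[of _ h])

lemma L1_approximable_cmult:
  assumes "L1_approximable f"
  shows "L1_approximable (\<lambda>x. c * f x)"
  unfolding L1_approximable_def
proof (intro conjI allI impI)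
  show "integrable P (\<lambda>x. c * f x)"
    using assms by (auto simp: L1_approximable_def)
  fix \<epsilon> :: real assume "0 < \<epsilon>"
  then have "0 < \<epsilon> / (\<bar>c\<bar> + 1)" by simp
  then obtain k h where h: "h \<in> borel_measurable (F k)" "integrable P h"
      and *: "(\<integral>x. \<bar>f x - h x\<bar> \<partial>P) < \<epsilon> / (\<bar>c\<bar> + 1)"
    using assms unfolding L1_approximable_def by meson
  have "(\<integral>x. \<bar>c * f x - c * h x\<bar> \<partial>P) = \<bar>c\<bar> * (\<integral>x. \<bar>f x - h x\<bar> \<partial>P)"
    by (simp add: right_diff_distrib[symmetric] abs_mult)
  also have "\<dots> \<le> (\<bar>c\<bar> + 1) * (\<integral>x. \<bar>f x - h x\<bar> \<partial>P)"
    by (intro mult_right_mono) auto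
  also have "\<dots> < \<epsilon>"
    using * by (simp add: pos_less_divide_eq mult.commute add_pos_nonneg)
  finally show "\<exists>k g. g \<in> borel_measurable (F k) \<and> integrable P g \<and> (\<integral>x. \<bar>c * f x - g x\<bar> \<partial>P) < \<epsilon>"
    using h by (intro exI[of _ k] exI[of _ "\<lambda>x. c * h x"]) auto
qed

lemma L1_approximable_add:
  assumes f: "L1_approximable f" and g: "L1_approximable g"
  shows "L1_approximable (\<lambda>x. f x + g x)"
  unfolding L1_approximable_def
proof (intro conjI allI impI)
  have [simp]: "integrable P f" "integrable P g"
    using f g by (auto simp: L1_approximable_def)
  show "integrable P (\<lambda>x. f x + g x)"
    by simp
  fix \<epsilon> :: real assume "0 < \<epsilon>"
  then have "0 < \<epsilon> / 2" by simp
  then obtain k h l j where h: "h \<in> borel_measurable (F k)" "integrable P h" "(\<integral>x. \<bar>f x - h x\<bar> \<partial>P) < \<epsilon> / 2"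
      and j: "j \<in> borel_measurable (F l)" "integrable P j" "(\<integral>x. \<bar>g x - j x\<bar> \<partial>P) < \<epsilon> / 2"
    using f g unfolding L1_approximable_def by meson
  have "(\<integral>x. \<bar>(f x + g x) - (h x + j x)\<bar> \<partial>P) \<le> (\<integral>x. \<bar>f x - h x\<bar> + \<bar>g x - j x\<bar> \<partial>P)"
    using h j by (intro integral_mono) auto
  also have "\<dots> < \<epsilon>"
    using h j by simp
  finally show "\<exists>k i. i \<in> borel_measurable (F k) \<and> integrable P i \<and> (\<integral>x. \<bar>(f x + g x) - i x\<bar> \<partial>P) < \<epsilon>"
    using h j by (intro exI[of _ "max k l"] exI[of _ "\<lambda>x. h x + j x"] conjI borel_measurable_add
      measurable_F_mono[OF _ h(1)] measurable_F_mono[OF _ j(1)]) auto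
qed

lemma L1_approximable_sum:
  assumes "finite I" "\<And>i. i \<in> I \<Longrightarrow> L1_approximable (f i)"
  shows "L1_approximable (\<lambda>x. \<Sum>i\<in>I. f i x)"
  using assms
  by (induction I rule: finite_induct)
     (auto intro: L1_approximable_add L1_approximable_F[of "\<lambda>_. 0" 0])

text \<open>
  The closure step for both inductions below, over sets and over integrable functions:
  each presents its limits as dominated pointwise ones.
\<close>

lemma L1_approximable_dominated_limit:
  assumes s: "\<And>i. L1_approximable (s i)"
    and lim: "\<And>x. x \<in> space P \<Longrightarrow> (\<lambda>i. s i x) \<longlonglongrightarrow> f x"
    and bound: "\<And>i x. x \<in> space P \<Longrightarrow> \<bar>s i x\<bar> \<le> w x" and w: "integrable P w"
  shows "L1_approximable f"
  unfolding L1_approximable_def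
proof (intro conjI allI impI)
  have s_int: "integrable P (s i)" for i
    using s by (auto simp: L1_approximable_def)
  then have [measurable]: "s i \<in> borel_measurable P" for i
    by auto
  have [measurable]: "f \<in> borel_measurable P"
    by (rule borel_measurable_LIMSEQ_metric[OF _ lim]) auto
  have f_bound: "\<bar>f x\<bar> \<le> w x" if "x \<in> space P" for x
    using LIMSEQ_le_const2[OF tendsto_rabs[OF lim[OF that]]] bound[OF that] by auto
  show f: "integrable P f"
    using w by (rule Bochner_Integration.integrable_bound) (auto intro!: AE_I2 order_trans[OF f_bound])
  fix \<epsilon> :: real assume "0 < \<epsilon>"
  have "(\<lambda>i. \<integral>x. \<bar>f x - s i x\<bar> \<partial>P) \<longlonglongrightarrow> (\<integral>x. 0 \<partial>P)"
  proof (rule integral_dominated_convergence[where w="\<lambda>x. 2 * w x"])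
    show "AE x in P. (\<lambda>i. \<bar>f x - s i x\<bar>) \<longlonglongrightarrow> 0"
    proof (intro AE_I2)
      fix x assume "x \<in> space P"
      then have "(\<lambda>i. \<bar>f x - s i x\<bar>) \<longlonglongrightarrow> \<bar>f x - f x\<bar>"
        by (intro tendsto_intros lim)
      then show "(\<lambda>i. \<bar>f x - s i x\<bar>) \<longlonglongrightarrow> 0"
        by simp
    qed
    show "AE x in P. norm \<bar>f x - s i x\<bar> \<le> 2 * w x" for i
    proof (intro AE_I2)
      fix x assume x: "x \<in> space P"
      show "norm \<bar>f x - s i x\<bar> \<le> 2 * w x"
        using bound[OF x, of i] f_bound[OF x] by simp
    qed
  qed (use w in auto)
  then have "eventually (\<lambda>i. (\<integral>x. \<bar>f x - s i x\<bar> \<partial>P) < \<epsilon> / 2) sequentially"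
    using \<open>0 < \<epsilon>\<close> by (intro order_tendstoD) auto
  then obtain i where i: "(\<integral>x. \<bar>f x - s i x\<bar> \<partial>P) < \<epsilon> / 2"
    by (auto simp: eventually_sequentially)
  have "0 < \<epsilon> / 2"
    using \<open>0 < \<epsilon>\<close> by simp
  then obtain k h where h: "h \<in> borel_measurable (F k)" "integrable P h" "(\<integral>x. \<bar>s i x - h x\<bar> \<partial>P) < \<epsilon> / 2"
    using s[of i] unfolding L1_approximable_def by meson
  have "(\<integral>x. \<bar>f x - h x\<bar> \<partial>P) \<le> (\<integral>x. \<bar>f x - s i x\<bar> + \<bar>s i x - h x\<bar> \<partial>P)"
    using h f s_int by (intro integral_mono) auto
  also have "\<dots> < \<epsilon>"
    using h i f s_int by simp
  finally show "\<exists>k h. h \<in> borel_measurable (F k) \<and> integrable P h \<and> (\<integral>x. \<bar>f x - h x\<bar> \<partial>P) < \<epsilon>"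
    using h by blast
qed

text \<open>
  The union of the \<open>F\<^sub>n\<close> is only an algebra, but it is stable under intersection, so it
  suffices to close its indicators under complements and countable disjoint unions.
\<close>

lemma L1_approximable_indicator:
  assumes "A \<in> sets F_inf"
  shows "L1_approximable (indicator A)"
proof -
  have "Int_stable (\<Union>n. sets (F n))"
  proof (rule Int_stableI)
    fix a b assume "a \<in> (\<Union>n. sets (F n))" "b \<in> (\<Union>n. sets (F n))"
    then obtain m n where "a \<in> sets (F m)" "b \<in> sets (F n)" by auto
    then have "a \<inter> b \<in> sets (F (max m n))"
      using sets_F_mono[of m "max m n"] sets_F_mono[of n "max m n"] by (intro sets.Int) auto
    then show "a \<inter> b \<in> (\<Union>n. sets (F n))" by auto
  qed
  moreover have "(\<Union>n. sets (F n)) \<subseteq> Pow (space P)"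
    using sets.sets_into_space by (fastforce simp: space_F)
  ultimately show ?thesis
    using assms unfolding sets_F_infinity[OF filtration_axioms]
  proof (induction rule: sigma_sets_induct_disjoint)
    case (basic A)
    then obtain n where A: "A \<in> sets (F n)" by auto
    then have "A \<in> sets P"
      using subalg_F by (auto simp: subalgebra_def)
    then show ?case
      using A by (intro L1_approximable_F[of _ n]) (auto simp: emeasure_eq_measure)
  next
    case empty
    then show ?case
      by (intro L1_approximable_F[of _ 0]) auto
  next
    case (compl A)
    have "L1_approximable (\<lambda>x. 1 + (-1) * indicator A x)"
      by (intro L1_approximable_add L1_approximable_cmult compl.IH) (auto intro: L1_approximable_F[of _ 0])
    then show ?case
    proof (rule L1_approximable_dominated_limit[where s="\<lambda>_. (\<lambda>x. 1 + (-1) * indicator A x)" and w="\<lambda>_. 1"])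
    qed (auto split: split_indicator)
  next
    case (union A)
    have "L1_approximable (\<lambda>x. \<Sum>i<n. indicator (A i) x)" for n
      by (intro L1_approximable_sum union.IH) auto
    then show ?case
    proof (rule L1_approximable_dominated_limit[where w="\<lambda>_. 1"])
      fix x
      have *: "(\<Sum>i<n. indicator (A i) x) = (indicator (\<Union>i<n. A i) x :: real)" for n
        using union.hyps(1) by (intro indicator_UN_disjoint[symmetric]) (auto simp: disjoint_family_on_def)
      show "(\<lambda>n. \<Sum>i<n. indicator (A i) x) \<longlonglongrightarrow> (indicator (\<Union>i. A i) x :: real)"
        unfolding * by (rule LIMSEQ_indicator_UN)
      show "\<bar>\<Sum>i<n. indicator (A i) x\<bar> \<le> (1::real)" for n
        unfolding * by (auto split: split_indicator)
    qed auto
  qed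
qed

lemma L1_approximable_F_inf:
  assumes "integrable P f" "f \<in> borel_measurable F_inf"
  shows "L1_approximable f"
  using integrable_in_subalg[OF subalg_F_inf assms(2,1)]
proof (induction rule: integrable_induct)
  case (base A c)
  then have "L1_approximable (\<lambda>x. c * indicator A x)"
    by (intro L1_approximable_cmult L1_approximable_indicator)
       (simp add: sets_restr_to_subalg[OF subalg_F_inf])
  then show ?case by (simp add: mult.commute)
next
  case (add f g)
  then show ?case by (intro L1_approximable_add)
next
  case (lim f s)
  then show ?case
    using integrable_from_subalg[OF subalg_F_inf lim.hyps(4)]
    by (intro L1_approximable_dominated_limit[of s f "\<lambda>x. 2 * \<bar>f x\<bar>"])
       (auto simp: space_restr_to_subalg)
qed

section \<open>Levy's upward theorem\<close>

text \<open>
  If \<open>h\<close> is \<open>F\<^sub>k\<close>-measurable and \<open>u = |f - h|\<close>, then \<open>|E[f | F\<^sub>n] - f| \<le> E[u | F\<^sub>n] + u\<close>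
  for all \<open>n \<ge> k\<close>. The maximal inequality and Markov's inequality bound the probability
  that either term ever exceeds \<open>c\<close> by \<open>E[u] / c\<close>, which density makes arbitrarily small.
\<close>

lemma levy_upward_measurable:
  assumes f: "integrable P f" "f \<in> borel_measurable F_inf"
  shows "AE x in P. (\<lambda>n. real_cond_exp P (F n) f x) \<longlonglongrightarrow> f x"
proof -
  define X where "X n = real_cond_exp P (F n) f" for n
  have [measurable]: "f \<in> borel_measurable P" "X n \<in> borel_measurable P" for n
    using f by (auto simp: X_def)
  have null: "AE x in P. \<exists>m. \<forall>n\<ge>m. \<bar>X n x - f x\<bar> \<le> 2 * c" if "0 < c" for c
  proof -
    \<comment> \<open>The points where the distance to \<open>f\<close> exceeds \<open>2c\<close> infinitely often.\<close>
    define B where "B = {x\<in>space P. \<forall>m. \<exists>n\<ge>m. 2 * c < \<bar>X n x - f x\<bar>}"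
    have [measurable]: "B \<in> sets P"
      unfolding B_def by measurable
    have B_bound: "measure P B \<le> \<epsilon>" if "0 < \<epsilon>" for \<epsilon>
    proof -
      \<comment> \<open>Each of the two bounds \<open>E[u] / c\<close> is then at most \<open>\<epsilon> / 2\<close>.\<close>
      have "0 < \<epsilon> * c / 2"
        using \<open>0 < \<epsilon>\<close> \<open>0 < c\<close> by simp
      then obtain k h where h: "h \<in> borel_measurable (F k)" "integrable P h"
          and close: "(\<integral>x. \<bar>f x - h x\<bar> \<partial>P) < \<epsilon> * c / 2"
        using L1_approximable_F_inf[OF f] unfolding L1_approximable_def by meson
      define u where "u x = \<bar>f x - h x\<bar>" for x
      have u[simp]: "integrable P u"
        using f h by (auto simp: u_def[abs_def])
      have u_small: "(\<integral>x. u x \<partial>P) / c \<le> \<epsilon> / 2"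
        using \<open>0 < c\<close> close by (simp add: u_def[abs_def] field_simps)
      have [measurable]: "u \<in> borel_measurable P"
        by (rule borel_measurable_integrable[OF u])
      have "AE x in P. k \<le> n \<longrightarrow> \<bar>X n x - f x\<bar> \<le> real_cond_exp P (F n) u x + u x" for n
      proof (cases "k \<le> n")
        case True
        interpret sigma_finite_subalgebra P "F n"
          by (intro cond_exp_subalgebra subalg_F)
        have "AE x in P. real_cond_exp P (F n) h x = h x"
          using h True by (intro real_cond_exp_F_meas measurable_F_mono[of k n])
        moreover have "AE x in P. real_cond_exp P (F n) (\<lambda>x. f x - h x) x = X n x - real_cond_exp P (F n) h x"
          unfolding X_def using f h by (intro real_cond_exp_diff)
        moreover have "AE x in P. real_cond_exp P (F n) (\<lambda>x. h x - f x) x = real_cond_exp P (F n) h x - X n x"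
          unfolding X_def using f h by (intro real_cond_exp_diff)
        moreover have "AE x in P. real_cond_exp P (F n) (\<lambda>x. f x - h x) x \<le> real_cond_exp P (F n) u x"
          using f h by (intro real_cond_exp_mono) (auto simp: u_def)
        moreover have "AE x in P. real_cond_exp P (F n) (\<lambda>x. h x - f x) x \<le> real_cond_exp P (F n) u x"
          using f h by (intro real_cond_exp_mono) (auto simp: u_def)
        ultimately show ?thesis
          by eventually_elim (auto simp: u_def)
      qed simp
      then have "AE x in P. \<forall>n. k \<le> n \<longrightarrow> \<bar>X n x - f x\<bar> \<le> real_cond_exp P (F n) u x + u x"
        by (simp add: AE_all_countable)
      then have "AE x in P. x \<in> B \<longrightarrow>
          x \<in> {x\<in>space P. \<exists>n. c < real_cond_exp P (F n) u x} \<union> {x\<in>space P. c \<le> u x}"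
      proof eventually_elim
        case (elim x)
        show ?case
        proof
          assume "x \<in> B"
          then obtain n where "k \<le> n" "2 * c < \<bar>X n x - f x\<bar>" "x \<in> space P"
            unfolding B_def by blast
          with elim have "c < real_cond_exp P (F n) u x \<or> c \<le> u x"
            by fastforce
          with \<open>x \<in> space P\<close>
          show "x \<in> {x\<in>space P. \<exists>n. c < real_cond_exp P (F n) u x} \<union> {x\<in>space P. c \<le> u x}"
            by blast
        qed
      qed
      then have "measure P B \<le> measure P ({x\<in>space P. \<exists>n. c < real_cond_exp P (F n) u x} \<union> {x\<in>space P. c \<le> u x})"
        by (intro finite_measure_mono_AE) auto
      also have "\<dots> \<le> measure P {x\<in>space P. \<exists>n. c < real_cond_exp P (F n) u x} + measure P {x\<in>space P. c \<le> u x}"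
        by (intro measure_Un_le) auto
      also have "\<dots> \<le> (\<integral>x. u x \<partial>P) / c + (\<integral>x. u x \<partial>P) / c"
        using \<open>0 < c\<close>
        by (intro add_mono maximal_inequality integral_Markov_inequality_measure[of _ _ "{}"] u)
           (auto simp: u_def)
      also have "\<dots> \<le> \<epsilon>"
        using u_small by linarith
      finally show ?thesis .
    qed
    have "measure P B \<le> 0"
      by (rule field_le_epsilon) (simp add: B_bound)
    then have "measure P B = 0"
      by (simp add: measure_le_0_iff)
    then have "AE x in P. x \<notin> B"
      by (intro AE_not_in) (auto simp: null_sets_def emeasure_eq_measure)
    then show ?thesis
      using AE_space by eventually_elim (auto simp: B_def not_less)
  qed
  have "AE x in P. \<forall>j. \<exists>m. \<forall>n\<ge>m. \<bar>X n x - f x\<bar> \<le> 2 * (1 / real (Suc j))"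
    unfolding AE_all_countable by (intro allI null) simp
  then show ?thesis
  proof eventually_elim
    case (elim x)
    show ?case
    proof (rule LIMSEQ_I)
      fix r :: real assume "0 < r"
      then obtain j where "inverse (real (Suc j)) < r / 2"
        using reals_Archimedean[of "r / 2"] by auto
      then have "2 * (1 / real (Suc j)) < r"
        by (simp add: inverse_eq_divide)
      moreover obtain m where "\<forall>n\<ge>m. \<bar>X n x - f x\<bar> \<le> 2 * (1 / real (Suc j))"
        using elim by blast
      ultimately have "\<forall>n\<ge>m. \<bar>X n x - f x\<bar> < r"
        by (blast intro: le_less_trans)
      then show "\<exists>m. \<forall>n\<ge>m. norm (real_cond_exp P (F n) f x - f x) < r"
        by (auto simp: X_def)
    qed
  qed
qed

text \<open>
  By the tower property \<open>f\<close> may be replaced by its projection on \<open>F\<^sub>\<infinity>\<close>, which the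
  preceding lemma covers.
\<close>

theorem levy_upward:
  assumes f: "integrable P f"
  shows "AE x in P. (\<lambda>n. real_cond_exp P (F n) f x) \<longlonglongrightarrow> real_cond_exp P F_inf f x"
proof -
  interpret inf: sigma_finite_subalgebra P F_inf
    by (intro cond_exp_subalgebra subalg_F_inf)
  have "AE x in P. real_cond_exp P (F n) (real_cond_exp P F_inf f) x = real_cond_exp P (F n) f x" for n
  proof -
    interpret sigma_finite_subalgebra P "F n"
      by (intro cond_exp_subalgebra subalg_F)
    show ?thesis
      by (intro real_cond_exp_nested_subalg subalg_F_inf subalg_F_F_inf f)
  qed
  then have "AE x in P. \<forall>n. real_cond_exp P (F n) (real_cond_exp P F_inf f) x = real_cond_exp P (F n) f x"
    by (simp add: AE_all_countable)
  moreover have "AE x in P. (\<lambda>n. real_cond_exp P (F n) (real_cond_exp P F_inf f) x) \<longlonglongrightarrow> real_cond_exp P F_inf f x"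
    using inf.real_cond_exp_int(1)[OF f] by (intro levy_upward_measurable) auto
  ultimately show ?thesis
    by eventually_elim simp
qed

section \<open>Optional stopping\<close>

text \<open>
  The integrals over \<open>{\<tau> = t} \<in> G\<^sub>t\<close> of \<open>E[f | G\<^sub>t]\<close> and of \<open>f\<close> agree by the definition of
  conditional expectation, and there are countably many values \<open>t\<close>. Non-negativity lets the
  sum over \<open>t\<close>, written as an integral over the counting measure, be exchanged with the
  integral over \<open>P\<close>.
\<close>

lemma optional_stopping:
  fixes f :: "'a \<Rightarrow> real"
  assumes f: "integrable P f" "AE x in P. 0 \<le> f x"
    and \<tau>: "stopping_time (extend_filtration (space P) F) \<tau>"
  shows "(\<integral>\<^sup>+x. ennreal (real_cond_exp P (extend_filtration (space P) F (\<tau> x)) f x) \<partial>P) = (\<integral>\<^sup>+x. ennreal (f x) \<partial>P)"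
proof -
  let ?G = "extend_filtration (space P) F"
  interpret G: filtration "space P" ?G
    by (rule filtration_extend[OF filtration_axioms])
  have A: "{x\<in>space P. \<tau> x = t} \<in> sets (?G t)" for t
    using G.stopping_time_eq_const[OF \<tau>, of t] by (simp add: pred_def G.space_F)
  have [measurable]: "{x\<in>space P. \<tau> x = t} \<in> sets P" for t
    using A[of t] subalg_extend by (auto simp: subalgebra_def)
  have [measurable]: "f \<in> borel_measurable P"
    using f by auto
  have decomp: "ennreal (g (\<tau> x) x) = (\<integral>\<^sup>+t. ennreal (g t x) * indicator {x\<in>space P. \<tau> x = t} x \<partial>count_space UNIV)"
    if "x \<in> space P" for x and g :: "enat \<Rightarrow> 'a \<Rightarrow> real"
  proof -
    have "(\<integral>\<^sup>+t. ennreal (g t x) * indicator {x\<in>space P. \<tau> x = t} x \<partial>count_space UNIV) =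
        (\<integral>\<^sup>+t. ennreal (g t x) * indicator {\<tau> x} t \<partial>count_space UNIV)"
      using that by (intro nn_integral_cong) (auto split: split_indicator)
    then show ?thesis
      by simp
  qed
  have local: "(\<integral>\<^sup>+x. ennreal (real_cond_exp P (?G t) f x) * indicator {x\<in>space P. \<tau> x = t} x \<partial>P) =
      (\<integral>\<^sup>+x. ennreal (f x) * indicator {x\<in>space P. \<tau> x = t} x \<partial>P)" for t
  proof -
    interpret sigma_finite_subalgebra P "?G t"
      by (intro cond_exp_subalgebra subalg_extend)
    have set_int: "(\<integral>\<^sup>+x. ennreal (g x) * indicator {x\<in>space P. \<tau> x = t} x \<partial>P) =
       ennreal (\<integral>x\<in>{x\<in>space P. \<tau> x = t}. g x \<partial>P)" if "integrable P g" "AE x in P. 0 \<le> g x" for g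
      unfolding nn_integral_set_ennreal set_lebesgue_integral_def
      using that(2) integrable_mult_indicator[OF _ that(1), of "{x\<in>space P. \<tau> x = t}"]
      by (subst nn_integral_eq_integral) (auto simp: mult.commute)
    have "(\<integral>\<^sup>+x. ennreal (real_cond_exp P (?G t) f x) * indicator {x\<in>space P. \<tau> x = t} x \<partial>P) =
       ennreal (\<integral>x\<in>{x\<in>space P. \<tau> x = t}. real_cond_exp P (?G t) f x \<partial>P)"
      by (intro set_int real_cond_exp_int(1) real_cond_exp_pos f) auto
    also have "\<dots> = ennreal (\<integral>x\<in>{x\<in>space P. \<tau> x = t}. f x \<partial>P)"
      using real_cond_exp_intA[OF f(1) A] by simp
    also have "\<dots> = (\<integral>\<^sup>+x. ennreal (f x) * indicator {x\<in>space P. \<tau> x = t} x \<partial>P)"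
      by (intro set_int[symmetric] f)
    finally show ?thesis .
  qed
  have "(\<integral>\<^sup>+x. ennreal (real_cond_exp P (?G (\<tau> x)) f x) \<partial>P) =
      (\<integral>\<^sup>+x. (\<integral>\<^sup>+t. ennreal (real_cond_exp P (?G t) f x) * indicator {x\<in>space P. \<tau> x = t} x \<partial>count_space UNIV) \<partial>P)"
    by (intro nn_integral_cong decomp)
  also have "\<dots> = (\<integral>\<^sup>+t. (\<integral>\<^sup>+x. ennreal (real_cond_exp P (?G t) f x) * indicator {x\<in>space P. \<tau> x = t} x \<partial>P) \<partial>count_space UNIV)"
    by (intro nn_integral_count_space_nn_integral) auto
  also have "\<dots> = (\<integral>\<^sup>+t. (\<integral>\<^sup>+x. ennreal (f x) * indicator {x\<in>space P. \<tau> x = t} x \<partial>P) \<partial>count_space UNIV)"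
    by (simp only: local)
  also have "\<dots> = (\<integral>\<^sup>+x. (\<integral>\<^sup>+t. ennreal (f x) * indicator {x\<in>space P. \<tau> x = t} x \<partial>count_space UNIV) \<partial>P)"
    by (intro nn_integral_count_space_nn_integral[symmetric]) auto
  also have "\<dots> = (\<integral>\<^sup>+x. ennreal (f x) \<partial>P)"
    by (intro nn_integral_cong decomp[symmetric])
  finally show ?thesis .
qed

end

section \<open>Measurability with respect to the stopped sigma-algebra\<close>

lemma measurable_stopped:
  fixes G :: "enat \<Rightarrow> 'a measure"
  assumes "filtration \<Omega> G" and T: "stopping_time G T"
    and Y: "\<And>t. Y t \<in> measurable (G t) N"
  shows "(\<lambda>x. Y (T x) x) \<in> measurable (filtration.pre_sigma \<Omega> G T) N"
proof -
  interpret filtration \<Omega> G by fact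
  show ?thesis
  proof (rule measurableI)
    fix x assume "x \<in> space (pre_sigma T)"
    then show "Y (T x) x \<in> space N"
      using measurable_space[OF Y] by (simp add: space_pre_sigma space_F)
  next
    fix B assume B: "B \<in> sets N"
    show "(\<lambda>x. Y (T x) x) -` B \<inter> space (pre_sigma T) \<in> sets (pre_sigma T)"
    proof (rule sets_pre_sigmaI[OF T])
      fix t
      have "{x\<in>\<Omega>. T x = s} \<inter> (Y s -` B \<inter> \<Omega>) \<in> sets (G t)" if "s \<le> t" for s
      proof -
        have "{x\<in>\<Omega>. T x = s} \<in> sets (G s)"
          using stopping_time_eq_const[OF T, of s] by (simp add: pred_def space_F)
        then have "{x\<in>\<Omega>. T x = s} \<inter> (Y s -` B \<inter> \<Omega>) \<in> sets (G s)"
          using measurable_sets[OF Y B, of s] unfolding space_F by (rule sets.Int)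
        then show ?thesis
          using sets_F_mono[OF that] by auto
      qed
      then have "(\<Union>s\<in>{..t}. {x\<in>\<Omega>. T x = s} \<inter> (Y s -` B \<inter> \<Omega>)) \<in> sets (G t)"
        by (intro sets.countable_UN') auto
      also have "(\<Union>s\<in>{..t}. {x\<in>\<Omega>. T x = s} \<inter> (Y s -` B \<inter> \<Omega>)) =
          {x \<in> (\<lambda>x. Y (T x) x) -` B \<inter> space (pre_sigma T). T x \<le> t}"
        by (auto simp: space_pre_sigma)
      finally show "{x \<in> (\<lambda>x. Y (T x) x) -` B \<inter> space (pre_sigma T). T x \<le> t} \<in> sets (G t)" .
    qed
  qed
qed

text \<open>
  A partial converse of the preceding lemma: on \<open>{T = t}\<close> the sigma-algebras at times \<open>T\<close>
  and \<open>t\<close> coincide. The function \<open>g\<close> fills the rest of the space, and choosing it freely is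
  what allows a modification of an essential infimum on \<open>{T = t}\<close> only.
\<close>

lemma measurable_localize:
  fixes G :: "'t::{linorder_topology, second_countable_topology} \<Rightarrow> 'a measure"
  assumes "filtration \<Omega> G" and T: "stopping_time G T"
    and f: "f \<in> measurable (filtration.pre_sigma \<Omega> G T) N"
    and g: "g \<in> measurable (G t) N"
  shows "(\<lambda>x. if T x = t then f x else g x) \<in> measurable (G t) N"
proof -
  interpret filtration \<Omega> G by fact
  have eq: "{x\<in>\<Omega>. T x = t} \<in> sets (G t)"
    using stopping_time_eq_const[OF T, of t] by (simp add: pred_def space_F)
  show ?thesis
  proof (rule measurableI)
    fix x assume "x \<in> space (G t)"
    then show "(if T x = t then f x else g x) \<in> space N"
      using measurable_space[OF f] measurable_space[OF g] by (auto simp: space_pre_sigma space_F)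
  next
    fix B assume B: "B \<in> sets N"
    have "{x \<in> f -` B \<inter> \<Omega>. T x \<le> t} \<in> sets (G t)"
      using sets_pre_sigmaD[OF T measurable_sets[OF f B], of t] by (simp add: space_pre_sigma)
    moreover have "g -` B \<inter> \<Omega> \<in> sets (G t)"
      using measurable_sets[OF g B] by (simp add: space_F)
    moreover have "(\<lambda>x. if T x = t then f x else g x) -` B \<inter> space (G t) =
        ({x \<in> f -` B \<inter> \<Omega>. T x \<le> t} \<inter> {x\<in>\<Omega>. T x = t}) \<union> ((g -` B \<inter> \<Omega>) - {x\<in>\<Omega>. T x = t})"
      by (auto simp: space_F split: if_splits)
    ultimately show "(\<lambda>x. if T x = t then f x else g x) -` B \<inter> space (G t) \<in> sets (G t)"
      by (simp only:) (intro sets.Un sets.Int[OF _ eq] sets.Diff[OF _ eq])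
  qed
qed

section \<open>Essential infima\<close>

lemma is_ess_inf_cong_AE:
  assumes "\<And>P. P \<in> H \<Longrightarrow> AE x in P. Z P x = Z' P x"
  shows "is_ess_inf G H Z Y \<longleftrightarrow> is_ess_inf G H Z' Y"
proof -
  have "(AE x in P. Y x \<le> Z P x) \<longleftrightarrow> (AE x in P. Y x \<le> Z' P x)" if "P \<in> H" for P and Y :: "'a \<Rightarrow> real"
  proof
    assume "AE x in P. Y x \<le> Z P x"
    with assms[OF that] show "AE x in P. Y x \<le> Z' P x"
      by eventually_elim simp
  next
    assume "AE x in P. Y x \<le> Z' P x"
    with assms[OF that] show "AE x in P. Y x \<le> Z P x"
      by eventually_elim simp
  qed
  then show ?thesis
    unfolding is_ess_inf_def by (simp cong: ball_cong)
qed

lemma is_ess_inf_unique: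
  assumes "is_ess_inf G H Z Y" "is_ess_inf G H Z Y'" "P \<in> H"
  shows "AE x in P. Y x = Y' x"
proof -
  have "AE x in P. Y x \<le> Y' x" "AE x in P. Y' x \<le> Y x"
    using assms unfolding is_ess_inf_def by blast+
  then show ?thesis by eventually_elim simp
qed

lemma is_ess_inf_lower: "is_ess_inf G H Z Y \<Longrightarrow> P \<in> H \<Longrightarrow> AE x in P. Y x \<le> Z P x"
  by (simp add: is_ess_inf_def)

lemma is_ess_inf_greatest:
  assumes "is_ess_inf G H Z Y" "Y' \<in> borel_measurable G" "\<And>P. P \<in> H \<Longrightarrow> AE x in P. Y' x \<le> Z P x" "P \<in> H"
  shows "AE x in P. Y' x \<le> Y x"
  using assms unfolding is_ess_inf_def by blast

text \<open>
  Essential infima are local. A lower bound \<open>Y'\<close> of the family \<open>f\<close> bounds the family \<open>Z\<^sub>t\<close>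
  from below on \<open>{T = t}\<close>; extended by \<open>Y\<^sub>t\<close> off that set it is a \<open>G\<^sub>t\<close>-measurable lower bound
  of \<open>Z\<^sub>t\<close> everywhere, hence at most \<open>Y\<^sub>t\<close>. Countably many null sets are discarded.
\<close>

lemma is_ess_inf_stopped:
  fixes G :: "enat \<Rightarrow> 'a measure"
  assumes G: "filtration \<Omega> G" and T: "stopping_time G T"
    and Y: "\<And>t. is_ess_inf (G t) H (Z t) (Y t)"
    and Z: "\<And>P t. P \<in> H \<Longrightarrow> AE x in P. T x = t \<longrightarrow> Z t P x = f P x"
  shows "is_ess_inf (filtration.pre_sigma \<Omega> G T) H f (\<lambda>x. Y (T x) x)"
  unfolding is_ess_inf_def
proof (intro conjI ballI allI impI)
  show "(\<lambda>x. Y (T x) x) \<in> borel_measurable (filtration.pre_sigma \<Omega> G T)"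
    using Y by (intro measurable_stopped[OF G T]) (simp add: is_ess_inf_def)
next
  fix P assume P: "P \<in> H"
  have "AE x in P. \<forall>t. Y t x \<le> Z t P x \<and> (T x = t \<longrightarrow> Z t P x = f P x)"
    unfolding AE_all_countable using is_ess_inf_lower[OF Y P] Z[OF P] by (auto simp: AE_conj_iff)
  then show "AE x in P. Y (T x) x \<le> f P x"
    by eventually_elim metis
next
  fix Y' P
  assume Y': "Y' \<in> borel_measurable (filtration.pre_sigma \<Omega> G T)" "\<forall>P\<in>H. AE x in P. Y' x \<le> f P x" and P: "P \<in> H"
  have "AE x in P. (if T x = t then Y' x else Y t x) \<le> Y t x" for t
  proof (rule is_ess_inf_greatest[OF Y _ _ P])
    show "(\<lambda>x. if T x = t then Y' x else Y t x) \<in> borel_measurable (G t)"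
      using Y[of t] by (intro measurable_localize[OF G T Y'(1)]) (simp add: is_ess_inf_def)
    fix Q assume Q: "Q \<in> H"
    then have "AE x in Q. Y' x \<le> f Q x"
      using Y'(2) by blast
    with Z[OF Q, of t] is_ess_inf_lower[OF Y[of t] Q]
    show "AE x in Q. (if T x = t then Y' x else Y t x) \<le> Z t Q x"
      by eventually_elim auto
  qed
  then have "AE x in P. \<forall>t. (if T x = t then Y' x else Y t x) \<le> Y t x"
    unfolding AE_all_countable by blast
  then show "AE x in P. Y' x \<le> Y (T x) x"
    by eventually_elim metis
qed

section \<open>Tests and their conditional expectations\<close>

context prob_filtration
begin

text \<open>
  The function \<open>f\<close> cut off outside \<open>{T = t} \<in> G\<^sub>t\<close> is \<open>G\<^sub>t\<close>-measurable, and the indicator of that set may be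
  pulled out of the conditional expectation.
\<close>

lemma cond_exp_eq_on_stopped:
  assumes f: "integrable P f" and T: "stopping_time (extend_filtration (space P) F) T"
    and f_meas: "f \<in> borel_measurable (F_stopped (space P) F T)"
  shows "AE x in P. T x = t \<longrightarrow> real_cond_exp P (extend_filtration (space P) F t) f x = f x"
proof -
  let ?G = "extend_filtration (space P) F"
  note G = filtration_extend[OF filtration_axioms]
  interpret G: filtration "space P" ?G
    by (rule G)
  interpret sigma_finite_subalgebra P "?G t"
    by (intro cond_exp_subalgebra subalg_extend)
  define A where "A = {x\<in>space P. T x = t}"
  have A: "A \<in> sets (?G t)"
    using G.stopping_time_eq_const[OF T, of t] by (simp add: A_def pred_def G.space_F)
  then have "A \<in> sets P"
    using subalg_extend by (auto simp: subalgebra_def)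
  then have fA: "integrable P (\<lambda>x. indicator A x * f x)"
    using f integrable_mult_indicator[of A P f] by simp
  have "(\<lambda>x. if T x = t then f x else 0) \<in> borel_measurable (?G t)"
    using f_meas by (intro measurable_localize[OF G T]) (auto simp: F_stopped_def)
  then have "(\<lambda>x. indicator A x * f x) \<in> borel_measurable (?G t)"
    by (rule measurable_cong[THEN iffD1, rotated]) (auto simp: A_def G.space_F)
  then have "AE x in P. real_cond_exp P (?G t) (\<lambda>x. indicator A x * f x) x = indicator A x * f x"
    by (intro real_cond_exp_F_meas fA)
  moreover have "AE x in P. real_cond_exp P (?G t) (\<lambda>x. indicator A x * f x) x = indicator A x * real_cond_exp P (?G t) f x"
    using f A fA by (intro real_cond_exp_mult) auto
  ultimately show ?thesis
    using AE_space by eventually_elim (auto simp: A_def)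
qed

lemma cond_test_inf_eq_cond_exp:
  assumes "integrable P (\<phi> P)"
  shows "AE x in P. cond_test_inf F \<phi> P x = real_cond_exp P F_inf (\<phi> P) x"
  using levy_upward[OF assms]
proof eventually_elim
  case (elim x)
  then have "limsup (\<lambda>n. ereal (cond_test F \<phi> n P x)) = ereal (real_cond_exp P F_inf (\<phi> P) x)"
    by (intro lim_imp_Limsup) (auto simp: cond_test_def)
  then show ?case
    by (simp add: cond_test_inf_def)
qed

end

lemma valid_test_iff:
  "valid_test M \<alpha> H \<phi> \<longleftrightarrow> is_test M \<phi> \<and> (\<forall>P\<in>H. integral\<^sup>L P \<phi> \<le> \<alpha>)"
  by (simp add: valid_test_def SUP_le_iff)

lemma is_test_integrable:
  assumes "is_test M \<phi>" "prob_space P" "sets P = sets M"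
  shows "integrable P \<phi>"
proof -
  interpret prob_space P by fact
  have "\<phi> \<in> borel_measurable P"
    using assms by (simp add: is_test_def cong: measurable_cong_sets)
  then show ?thesis
    using assms(1) sets_eq_imp_space_eq[OF assms(3)]
    by (intro integrable_const_bound[of _ 1]) (auto simp: is_test_def)
qed

theorem theorem2:
  fixes M :: "'a measure"
    and H :: "'a measure set"
    and F :: "nat \<Rightarrow> 'a measure"
    and \<alpha> :: real
    and \<phi> :: "'a measure \<Rightarrow> 'a \<Rightarrow> real"
    and \<phi>H :: "nat \<Rightarrow> 'a \<Rightarrow> real"
    and \<phi>H_inf :: "'a \<Rightarrow> real"
  assumes prob: "\<And>P. P \<in> H \<Longrightarrow> prob_space P"
    and sets_P: "\<And>P. P \<in> H \<Longrightarrow> sets P = sets M"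
    and filt: "filtration (space M) F"
    and sub: "\<And>n. subalgebra M (F n)"
    and F0: "sets (F 0) = {{}, space M}"
    and alpha: "\<alpha> > 0"
    and test: "\<And>P. P \<in> H \<Longrightarrow> is_test M (\<phi> P)"
    and ess_inf_n: "\<And>n. is_ess_inf (F n) H (cond_test F \<phi> n) (\<phi>H n)"
    and test_n: "\<And>n. is_test (F n) (\<phi>H n)"
    and ess_inf_inf: "is_ess_inf (F_infinity (space M) F) H (cond_test_inf F \<phi>) \<phi>H_inf"
    and test_inf: "is_test (F_infinity (space M) F) \<phi>H_inf"
  shows
    "((\<forall>P\<in>H. valid_test M \<alpha> {P} (\<phi> P)) \<longrightarrow> anytime_valid M F \<alpha> H \<phi>H \<phi>H_inf)
     \<and>
     (\<forall>\<psi>. (\<forall>P\<in>H. \<phi> P \<in> borel_measurable (F_infinity (space M) F)) \<longrightarrow>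
           is_ess_inf (F_infinity (space M) F) H \<phi> \<psi> \<longrightarrow>
           is_test (F_infinity (space M) F) \<psi> \<longrightarrow>
           \<not> valid_test M \<alpha> H \<psi> \<longrightarrow>
           \<not> anytime_valid M F \<alpha> H \<phi>H \<phi>H_inf)
     \<and>
     (\<forall>\<tau> \<psi>. stopping_time (extend_filtration (space M) F) \<tau> \<longrightarrow>
           (\<forall>P\<in>H. \<phi> P \<in> borel_measurable (F_stopped (space M) F \<tau>)) \<longrightarrow>
           is_ess_inf (F_stopped (space M) F \<tau>) H \<phi> \<psi> \<longrightarrow>
           (\<forall>P\<in>H. AE x in P. stopped_seq \<phi>H \<phi>H_inf \<tau> x = \<psi> x))"
proof -
  let ?G = "extend_filtration (space M) F"
  let ?Finf = "F_infinity (space M) F"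
  \<comment> \<open>The essential infima as one family over all times, \<open>\<infinity>\<close> included.\<close>
  define Y where "Y t = (case t of enat n \<Rightarrow> \<phi>H n | \<infinity> \<Rightarrow> \<phi>H_inf)" for t
  have stopped: "stopped_seq \<phi>H \<phi>H_inf \<tau> = (\<lambda>x. Y (\<tau> x) x)" for \<tau>
    by (auto simp: stopped_seq_def Y_def split: enat.split)
  note G = filtration_extend[OF filt]
  interpret G: filtration "space M" ?G by (rule G)
  have space_P: "space P = space M" if "P \<in> H" for P
    using sets_P[OF that] by (rule sets_eq_imp_space_eq)
  have pf: "prob_filtration P F" if "P \<in> H" for P
    using prob[OF that] filt sub sets_P[OF that] space_P[OF that]
    by (simp add: prob_filtration_def prob_filtration_axioms_def subalgebra_def)
  have int: "integrable P (\<phi> P)" if "P \<in> H" for P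
    using is_test_integrable[OF test prob sets_P] that by blast
  have nonneg: "AE x in P. 0 \<le> \<phi> P x" if "P \<in> H" for P
    using test[OF that] space_P[OF that] by (auto simp: is_test_def)
  have Finf_M: "sets ?Finf \<subseteq> sets M" "space ?Finf = space M"
    using subalgebra_F_infinity[OF filt sub] by (auto simp: subalgebra_def)
  have Finf_test: "is_test M \<psi>" if "is_test ?Finf \<psi>" for \<psi>
    using that Finf_M by (auto simp: is_test_def measurable_def)
  have limit: "AE x in P. cond_test_inf F \<phi> P x = real_cond_exp P ?Finf (\<phi> P) x" if "P \<in> H" for P
    using prob_filtration.cond_test_inf_eq_cond_exp[OF pf[OF that], of \<phi>] int[OF that]
    by (simp add: space_P[OF that])
  have ess_inf: "is_ess_inf (?G t) H (\<lambda>P. real_cond_exp P (?G t) (\<phi> P)) (Y t)" for t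
  proof (cases t)
    case (enat n)
    then show ?thesis
      using ess_inf_n[of n] by (simp add: extend_filtration_def Y_def cond_test_def[abs_def])
  next
    case infinity
    then show ?thesis
      using ess_inf_inf is_ess_inf_cong_AE[OF limit] by (simp add: extend_filtration_def Y_def)
  qed
  have Y_bounds: "0 \<le> Y t x \<and> Y t x \<le> 1" if "x \<in> space M" for t x
    using test_n test_inf that Finf_M(2) filtration.space_F[OF filt]
    by (auto simp: Y_def is_test_def split: enat.split)
  have test_stopped: "is_test M (\<lambda>x. Y (\<tau> x) x)" if \<tau>: "stopping_time ?G \<tau>" for \<tau>
  proof -
    have "(\<lambda>x. Y (\<tau> x) x) \<in> borel_measurable (F_stopped (space M) F \<tau>)"
      unfolding F_stopped_def
      using ess_inf by (intro measurable_stopped[OF G \<tau>]) (simp add: is_ess_inf_def)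
    then have "(\<lambda>x. Y (\<tau> x) x) \<in> borel_measurable ?Finf"
      using sets_F_stopped[OF filt \<tau>] Finf_M(2) G.space_pre_sigma
      by (auto simp: measurable_def F_stopped_def)
    then show ?thesis
      using Y_bounds Finf_M by (auto simp: is_test_def measurable_def)
  qed
  have part1: "anytime_valid M F \<alpha> H \<phi>H \<phi>H_inf" if valid: "\<forall>P\<in>H. valid_test M \<alpha> {P} (\<phi> P)"
    unfolding anytime_valid_def stopped valid_test_iff
  proof (intro allI impI conjI ballI)
    fix \<tau> P assume \<tau>: "stopping_time ?G \<tau>"
    show "is_test M (\<lambda>x. Y (\<tau> x) x)"
      by (rule test_stopped[OF \<tau>])
    assume P: "P \<in> H"
    have "AE x in P. \<forall>t. Y t x \<le> real_cond_exp P (?G t) (\<phi> P) x"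
      unfolding AE_all_countable using is_ess_inf_lower[OF ess_inf P] by blast
    then have "AE x in P. Y (\<tau> x) x \<le> real_cond_exp P (?G (\<tau> x)) (\<phi> P) x"
      by eventually_elim blast
    then have "(\<integral>\<^sup>+x. ennreal (Y (\<tau> x) x) \<partial>P) \<le> (\<integral>\<^sup>+x. ennreal (real_cond_exp P (?G (\<tau> x)) (\<phi> P) x) \<partial>P)"
      by (intro nn_integral_mono_AE) (auto intro: ennreal_leI)
    also have "\<dots> = (\<integral>\<^sup>+x. ennreal (\<phi> P x) \<partial>P)"
      using prob_filtration.optional_stopping[OF pf[OF P] int[OF P] nonneg[OF P], of \<tau>] \<tau>
      by (simp add: space_P[OF P])
    finally have "(\<integral>\<^sup>+x. ennreal (Y (\<tau> x) x) \<partial>P) \<le> (\<integral>\<^sup>+x. ennreal (\<phi> P x) \<partial>P)" .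
    moreover have "AE x in P. 0 \<le> Y (\<tau> x) x"
      using Y_bounds by (intro AE_I2) (auto simp: space_P[OF P])
    ultimately have "ennreal (\<integral>x. Y (\<tau> x) x \<partial>P) \<le> ennreal (\<integral>x. \<phi> P x \<partial>P)"
      using is_test_integrable[OF test_stopped[OF \<tau>] prob[OF P] sets_P[OF P]] int[OF P] nonneg[OF P]
      by (simp add: nn_integral_eq_integral)
    then have "(\<integral>x. Y (\<tau> x) x \<partial>P) \<le> (\<integral>x. \<phi> P x \<partial>P)"
      using integral_nonneg_AE[OF nonneg[OF P]] by (simp add: ennreal_le_iff)
    also have "\<dots> \<le> \<alpha>"
      using valid P by (simp add: valid_test_iff)
    finally show "(\<integral>x. Y (\<tau> x) x \<partial>P) \<le> \<alpha>" .
  qed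
  have part3: "AE x in P. stopped_seq \<phi>H \<phi>H_inf \<tau> x = \<psi> x"
    if \<tau>: "stopping_time ?G \<tau>"
      and meas: "\<forall>P\<in>H. \<phi> P \<in> borel_measurable (F_stopped (space M) F \<tau>)"
      and \<psi>: "is_ess_inf (F_stopped (space M) F \<tau>) H \<phi> \<psi>"
      and P: "P \<in> H" for \<tau> \<psi> P
  proof -
    have "is_ess_inf (F_stopped (space M) F \<tau>) H \<phi> (\<lambda>x. Y (\<tau> x) x)"
      unfolding F_stopped_def
    proof (rule is_ess_inf_stopped[OF G \<tau> ess_inf])
      fix Q t assume Q: "Q \<in> H"
      show "AE x in Q. \<tau> x = t \<longrightarrow> real_cond_exp Q (?G t) (\<phi> Q) x = \<phi> Q x"
        using prob_filtration.cond_exp_eq_on_stopped[OF pf[OF Q] int[OF Q], of \<tau>] \<tau> meas Q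
        by (simp add: space_P[OF Q])
    qed
    from is_ess_inf_unique[OF this \<psi> P] show ?thesis
      by (simp add: stopped)
  qed
  have part2: "valid_test M \<alpha> H \<psi>"
    if meas: "\<forall>P\<in>H. \<phi> P \<in> borel_measurable ?Finf"
      and \<psi>: "is_ess_inf ?Finf H \<phi> \<psi>" "is_test ?Finf \<psi>"
      and valid: "anytime_valid M F \<alpha> H \<phi>H \<phi>H_inf" for \<psi>
    unfolding valid_test_iff
  proof (intro conjI ballI)
    show "is_test M \<psi>"
      by (rule Finf_test[OF \<psi>(2)])
    fix P assume P: "P \<in> H"
    \<comment> \<open>At the constant time \<open>\<infinity>\<close> the stopped sigma-algebra is \<open>F\<^sub>\<infinity>\<close>.\<close>
    let ?\<tau> = "\<lambda>_::'a. \<infinity>::enat"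
    have \<tau>: "stopping_time ?G ?\<tau>"
      by (rule stopping_time_const)
    have sets_eq: "sets (F_stopped (space M) F ?\<tau>) = sets ?Finf"
      unfolding sets_F_stopped[OF filt \<tau>] by auto
    then have meas_eq: "borel_measurable (F_stopped (space M) F ?\<tau>) = (borel_measurable ?Finf :: ('a \<Rightarrow> real) set)"
      by (intro measurable_cong_sets) auto
    have "AE x in P. \<phi>H_inf x = \<psi> x"
      using part3[OF \<tau> _ _ P, of \<psi>] meas \<psi>(1) by (simp add: is_ess_inf_def meas_eq stopped_seq_def)
    then have "(\<integral>x. \<psi> x \<partial>P) = (\<integral>x. \<phi>H_inf x \<partial>P)"
      using Finf_test[OF \<psi>(2)] Finf_test[OF test_inf] sets_P[OF P]
      by (intro integral_cong_AE) (auto simp: is_test_def cong: measurable_cong_sets)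
    moreover have "stopped_seq \<phi>H \<phi>H_inf ?\<tau> = \<phi>H_inf"
      by (simp add: stopped_seq_def fun_eq_iff)
    then have "valid_test M \<alpha> H \<phi>H_inf"
      using valid \<tau> unfolding anytime_valid_def by metis
    ultimately show "(\<integral>x. \<psi> x \<partial>P) \<le> \<alpha>"
      using P by (simp add: valid_test_iff)
  qed
  show ?thesis
    using part1 part2 part3 by blast
qed

end
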